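(* Let $G_1$ and $G_2$ be finite groups each of which can be generated by two elements. If $G_1$ and $G_2$ are isoclinic, then $$\{\operatorname{ord}([x,y]) : x,y\in G_1,\ \langle x,y\rangle=G_1\}=\{\operatorname{ord}([x,y]) : x,y\in G_2,\ \langle x,y\rangle=G_2\}.$$
   Context: Write $[x,y]=x^{-1}y^{-1}xy$, $Z(G)$ for the center and $G'$ for the commutator subgroup of $G$. The commutator induces a well-defined map $G/Z(G)\times G/Z(G)\to G'$. Two groups $G_1,G_2$ are isoclinic if there are isomorphisms $\phi:G_1/Z(G_1)\to G_2/Z(G_2)$ and $\psi:G_1'\to G_2'$ such that $\psi([\bar x,\bar y])=[\phi(\bar x),\phi(\bar y)]$ for all $\bar x,\bar y\in G_1/Z(G_1)$. *)

theory Defs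
  imports "HOL-Algebra.Algebra"
begin

definition commutator :: "('a, 'b) monoid_scheme \<Rightarrow> 'a \<Rightarrow> 'a \<Rightarrow> 'a" where
  "commutator G x y = inv\<^bsub>G\<^esub> x \<otimes>\<^bsub>G\<^esub> inv\<^bsub>G\<^esub> y \<otimes>\<^bsub>G\<^esub> x \<otimes>\<^bsub>G\<^esub> y"

definition center :: "('a, 'b) monoid_scheme \<Rightarrow> 'a set" where
  "center G = {z \<in> carrier G. \<forall>g \<in> carrier G. z \<otimes>\<^bsub>G\<^esub> g = g \<otimes>\<^bsub>G\<^esub> z}"

(* The commutator subgroup G' as a group in its own right. The library's
   derived uses the other convention, x y x^-1 y^-1, for commutators;
   derived_eq_generate_commutators shows that the subgroup is the same. *)
abbreviation derived_group :: "('a, 'b) monoid_scheme \<Rightarrow> ('a, 'b) monoid_scheme" where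
  "derived_group G \<equiv> G\<lparr>carrier := derived G (carrier G)\<rparr>"

(* The map G/Z(G) x G/Z(G) -> G' induced by the commutator. On two cosets of the
   center the set below is a singleton; see coset_commutator_rcos. *)
definition coset_commutator :: "('a, 'b) monoid_scheme \<Rightarrow> 'a set \<Rightarrow> 'a set \<Rightarrow> 'a" where
  "coset_commutator G A B = the_elem {commutator G x y | x y. x \<in> A \<and> y \<in> B}"

definition isoclinic :: "('a, 'c) monoid_scheme \<Rightarrow> ('b, 'd) monoid_scheme \<Rightarrow> bool" where
  "isoclinic G H \<longleftrightarrow>
     (\<exists>\<phi> \<in> iso (G Mod center G) (H Mod center H).
      \<exists>\<psi> \<in> iso (derived_group G) (derived_group H).
      \<forall>A \<in> carrier (G Mod center G). \<forall>B \<in> carrier (G Mod center G).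
        \<psi> (coset_commutator G A B) = coset_commutator H (\<phi> A) (\<phi> B))"

context group
begin

lemma commutator_closed [simp]:
  "x \<in> carrier G \<Longrightarrow> y \<in> carrier G \<Longrightarrow> commutator G x y \<in> carrier G"
  by (simp add: commutator_def)

lemma derived_eq_generate_commutators:
  "derived G (carrier G) =
     generate G {commutator G x y | x y. x \<in> carrier G \<and> y \<in> carrier G}"
proof -
  have "derived_set G (carrier G) =
          {commutator G x y | x y. x \<in> carrier G \<and> y \<in> carrier G}" (is "?D = ?C")
  proof
    show "?D \<subseteq> ?C"
    proof
      fix c assume "c \<in> ?D"
      then obtain x y where xy: "x \<in> carrier G" "y \<in> carrier G"
        and c: "c = x \<otimes> y \<otimes> inv x \<otimes> inv y" by (elim UN_E) simp
      have "c = commutator G (inv x) (inv y) \<and> inv x \<in> carrier G \<and> inv y \<in> carrier G"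
        using xy c by (simp add: commutator_def)
      then show "c \<in> ?C" by (intro CollectI exI)
    qed
    show "?C \<subseteq> ?D"
    proof
      fix c assume "c \<in> ?C"
      then obtain x y where xy: "x \<in> carrier G" "y \<in> carrier G"
        and c: "c = commutator G x y" by (elim CollectE exE conjE)
      have "c \<in> {inv x \<otimes> inv y \<otimes> inv (inv x) \<otimes> inv (inv y)}"
        using xy c by (simp add: commutator_def)
      then show "c \<in> ?D"
        by (rule UN_I[OF inv_closed[OF xy(1)] UN_I[OF inv_closed[OF xy(2)]]])
    qed
  qed
  then show ?thesis by (simp add: derived_def)
qed

lemma center_normal: "center G \<lhd> G"
proof (rule normal_invI)
  show "subgroup (center G) G"
  proof (rule subgroupI)
    show "center G \<subseteq> carrier G" "center G \<noteq> {}"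
      by (auto simp: center_def)
  next
    fix a assume a: "a \<in> center G"
    have "inv a \<otimes> g = g \<otimes> inv a" if g: "g \<in> carrier G" for g
    proof -
      have "a \<otimes> inv g = inv g \<otimes> a" using a g by (simp add: center_def)
      then have "inv (a \<otimes> inv g) = inv (inv g \<otimes> a)" by simp
      moreover have "a \<in> carrier G" using a by (simp add: center_def)
      ultimately show ?thesis using g by (simp add: inv_mult_group)
    qed
    then show "inv a \<in> center G" using a by (simp add: center_def)
  next
    fix a b assume ab: "a \<in> center G" "b \<in> center G"
    then have c: "a \<in> carrier G" "b \<in> carrier G"
      by (auto simp: center_def)
    have "a \<otimes> b \<otimes> g = g \<otimes> (a \<otimes> b)" if g: "g \<in> carrier G" for g
    proof -
      have ag: "a \<otimes> g = g \<otimes> a" and bg: "b \<otimes> g = g \<otimes> b"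
        using ab g by (auto simp: center_def)
      have "a \<otimes> b \<otimes> g = a \<otimes> (g \<otimes> b)"
        using c g by (simp add: m_assoc bg)
      also have "\<dots> = g \<otimes> a \<otimes> b"
        using c g by (simp only: m_assoc[symmetric] ag)
      finally show ?thesis using c g by (simp add: m_assoc)
    qed
    then show "a \<otimes> b \<in> center G" using c by (simp add: center_def)
  qed
next
  fix x h assume x: "x \<in> carrier G" and h: "h \<in> center G"
  then have "h \<in> carrier G" "x \<otimes> h = h \<otimes> x"
    by (auto simp: center_def)
  then have "x \<otimes> h \<otimes> inv x = h"
    using x by (simp add: m_assoc)
  with h show "x \<otimes> h \<otimes> inv x \<in> center G" by simp
qed

lemma conjugate_center_mult:
  assumes w: "w \<in> center G" and y: "y \<in> carrier G" and a: "a \<in> carrier G"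
  shows "inv (w \<otimes> y) \<otimes> a \<otimes> (w \<otimes> y) = inv y \<otimes> a \<otimes> y"
proof -
  have wc: "w \<in> carrier G" and aw: "a \<otimes> w = w \<otimes> a"
    using w a by (auto simp: center_def)
  have "inv (w \<otimes> y) \<otimes> a \<otimes> (w \<otimes> y) = inv y \<otimes> (inv w \<otimes> (a \<otimes> w)) \<otimes> y"
    using wc y a by (simp add: inv_mult_group m_assoc)
  also have "inv w \<otimes> (a \<otimes> w) = a"
    unfolding aw using wc a by (simp add: m_assoc[symmetric])
  finally show ?thesis .
qed

lemma commutator_center_mult:
  assumes z: "z \<in> center G" and w: "w \<in> center G"
    and x: "x \<in> carrier G" and y: "y \<in> carrier G"
  shows "commutator G (z \<otimes> x) (w \<otimes> y) = commutator G x y"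
proof -
  have c: "z \<in> carrier G" "w \<in> carrier G"
    using z w by (auto simp: center_def)
  have "commutator G (z \<otimes> x) (w \<otimes> y) = inv (z \<otimes> x) \<otimes> (inv (w \<otimes> y) \<otimes> (z \<otimes> x) \<otimes> (w \<otimes> y))"
    using x y c by (simp add: commutator_def m_assoc)
  also have "\<dots> = inv (z \<otimes> x) \<otimes> (inv y \<otimes> (z \<otimes> x) \<otimes> y)"
    using x y c conjugate_center_mult[OF w y] by simp
  also have "\<dots> = (inv (z \<otimes> x) \<otimes> inv y \<otimes> (z \<otimes> x)) \<otimes> y"
    using x y c by (simp add: m_assoc)
  also have "\<dots> = commutator G x y"
    using y conjugate_center_mult[OF z x] by (simp add: commutator_def)
  finally show ?thesis .
qed

lemma coset_commutator_rcos:
  assumes "x \<in> carrier G" "y \<in> carrier G"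
  shows "coset_commutator G (center G #> x) (center G #> y) = commutator G x y"
proof -
  have one: "\<one> \<in> center G" by (simp add: center_def)
  have in_rcos: "u \<in> center G #> u" if "u \<in> carrier G" for u
    unfolding r_coset_def using one that by force
  have "{commutator G u v | u v. u \<in> center G #> x \<and> v \<in> center G #> y} = {commutator G x y}"
  proof
    show "{commutator G u v | u v. u \<in> center G #> x \<and> v \<in> center G #> y} \<subseteq> {commutator G x y}"
      unfolding r_coset_def using assms commutator_center_mult by blast
    show "{commutator G x y} \<subseteq> {commutator G u v | u v. u \<in> center G #> x \<and> v \<in> center G #> y}"
      using in_rcos assms by blast
  qed
  then show ?thesis by (simp add: coset_commutator_def)
qed

end

end

theory Submission
  imports Defs
begin

text \<open>
  The theorem combines two facts.

  Isoclinism sees generating pairs only modulo the center. If \<open>x, y\<close> generate \<open>G1\<close>, the isomorphism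
  \<open>\<phi>\<close> of central quotients sends their cosets to a pair of cosets \<open>A, B\<close> that generates
  \<open>G2 Mod center G2\<close>. A commutator depends only on the central cosets of its entries, so every
  choice of \<open>u \<in> A\<close> and \<open>v \<in> B\<close> satisfies \<open>\<psi> [x, y] = [u, v]\<close>. As \<open>\<psi>\<close> is an isomorphism of commutator
  subgroups, \<open>[u, v]\<close> has the same order as \<open>[x, y]\<close>.

  It remains to choose \<open>u, v\<close> so that they generate \<open>G2\<close> itself, although arbitrary representatives
  need not do so. This is Gaschuetz's lemma (\<open>generating_family_lifts\<close>): if a finite group is
  generated by a family indexed by \<open>I\<close>, then every \<open>I\<close>-indexed generating family of a quotient
  lifts to a generating family of the group. It follows from a counting argument: the number of
  generating lifts is the same for all generating families of the quotient
  (\<open>card_lifts_generating_independent\<close>), and it is positive for the image of a generating family of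
  the group.

  Isoclinism is symmetric, so the inclusion obtained in this way gives equality.
\<close>

section \<open>Lifting generating families from a quotient\<close>

context group
begin

text \<open>
  These are the subgroups \<open>C\<close> with \<open>N C = G\<close>, in the form that the proofs use: the quotient map is
  onto already on \<open>C\<close>.
\<close>
definition supplements :: "'a set \<Rightarrow> 'a set set" where
  "supplements N = {C. subgroup C G \<and> (\<lambda>c. N #> c) ` C = carrier (G Mod N)}"

definition lifts_generating :: "'i set \<Rightarrow> ('i \<Rightarrow> 'a set) \<Rightarrow> 'a set \<Rightarrow> ('i \<Rightarrow> 'a) set" where
  "lifts_generating I A C = {t \<in> Pi\<^sub>E I A. generate G (t ` I) = C}"

lemma coset_eq_of_mem:
  assumes "N \<lhd> G" "R \<in> carrier (G Mod N)" "r \<in> R"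
  shows "r \<in> carrier G" "N #> r = R"
proof -
  interpret N: normal N G by fact
  obtain a where a: "a \<in> carrier G" "R = N #> a"
    using assms(2) by (auto simp: carrier_FactGroup)
  show "r \<in> carrier G"
    using a assms(3) N.elemrcos_carrier by blast
  show "N #> r = R"
    using a assms(3) repr_independence N.subgroup_axioms by metis
qed

text \<open>
  A supplement of \<open>N\<close> contains a representative \<open>c\<close> of each coset, so the part of the coset inside the
  supplement is the translate by \<open>c\<close> of the part of \<open>N\<close> inside it.
\<close>
lemma card_coset_Int_supplement:
  assumes N: "N \<lhd> G" and C: "C \<in> supplements N" and R: "R \<in> carrier (G Mod N)"
  shows "card (R \<inter> C) = card (N \<inter> C)"
proof -
  interpret N: normal N G by fact
  interpret C: subgroup C G using C by (simp add: supplements_def)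
  obtain c where c: "c \<in> C" "R = N #> c"
    using C R by (auto simp: supplements_def)
  have "R \<inter> C = (N \<inter> C) #> c"
  proof (intro equalityI subsetI)
    fix r assume "r \<in> R \<inter> C"
    then obtain n where n: "n \<in> N" "r = n \<otimes> c" "r \<in> C"
      using c by (auto simp: r_coset_def)
    then have "r \<otimes> inv c = n"
      using c by (simp add: m_assoc)
    then have "n \<in> C"
      using n c C.m_closed[of r "inv c"] by simp
    then show "r \<in> (N \<inter> C) #> c"
      using n by (auto simp: r_coset_def)
  next
    fix r assume "r \<in> (N \<inter> C) #> c"
    then show "r \<in> R \<inter> C"
      using c by (auto simp: r_coset_def)
  qed
  moreover have "(N \<inter> C) #> c \<in> rcosets (N \<inter> C)"
    using c C.subset by (auto simp: RCOSETS_def)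
  ultimately show ?thesis
    using card_rcosets_equal[of "R \<inter> C" "N \<inter> C"] C.subset by (metis le_infI2)
qed

text \<open>
  The quotient map carries the subgroup generated by a lift of \<open>A\<close> onto the subgroup generated by \<open>A\<close>,
  which is the whole quotient.
\<close>
lemma generate_lift_in_supplements:
  assumes N: "N \<lhd> G"
    and A: "A \<in> I \<rightarrow> carrier (G Mod N)" "generate (G Mod N) (A ` I) = carrier (G Mod N)"
    and t: "t \<in> Pi\<^sub>E I A"
  shows "generate G (t ` I) \<in> supplements N"
proof -
  interpret N: normal N G by fact
  interpret quot: group_hom G "G Mod N" "\<lambda>g. N #> g"
    by (intro group_hom.intro group_hom_axioms.intro is_group N.factorgroup_is_group N.r_coset_hom_Mod)
  have t_carrier: "t ` I \<subseteq> carrier G" and coset: "\<And>i. i \<in> I \<Longrightarrow> N #> t i = A i"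
    using A(1) t coset_eq_of_mem[OF N] by blast+
  have "(\<lambda>g. N #> g) ` (t ` I) = A ` I"
    using coset by (force simp: image_iff)
  then show ?thesis
    using quot.generate_img[OF t_carrier] A(2) generate_is_subgroup[OF t_carrier]
    by (simp add: supplements_def)
qed

text \<open>
  Sorting the lifts with entries in \<open>C\<close> by the subgroup that they generate is what makes the
  recursive count below possible: that subgroup is again a supplement, so the recursion stays among
  supplements.
\<close>
lemma lifts_in_subgroup_eq_UN:
  assumes N: "N \<lhd> G"
    and A: "A \<in> I \<rightarrow> carrier (G Mod N)" "generate (G Mod N) (A ` I) = carrier (G Mod N)"
    and C: "subgroup C G"
  shows "(\<Pi>\<^sub>E i\<in>I. A i \<inter> C) = (\<Union>D\<in>{D \<in> supplements N. D \<subseteq> C}. lifts_generating I A D)"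
proof (intro equalityI subsetI)
  fix t assume t: "t \<in> (\<Pi>\<^sub>E i\<in>I. A i \<inter> C)"
  then have "t \<in> Pi\<^sub>E I A" "t ` I \<subseteq> C"
    by (auto simp: PiE_def)
  then show "t \<in> (\<Union>D\<in>{D \<in> supplements N. D \<subseteq> C}. lifts_generating I A D)"
    using generate_lift_in_supplements[OF N A] generate_subgroup_incl[OF _ C]
    by (auto simp: lifts_generating_def)
next
  fix t assume "t \<in> (\<Union>D\<in>{D \<in> supplements N. D \<subseteq> C}. lifts_generating I A D)"
  then have "t \<in> Pi\<^sub>E I A" "generate G (t ` I) \<subseteq> C"
    by (auto simp: lifts_generating_def)
  moreover have "t i \<in> generate G (t ` I)" if "i \<in> I" for i
    using that by (intro generate.incl) simp
  ultimately show "t \<in> (\<Pi>\<^sub>E i\<in>I. A i \<inter> C)"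
    by (auto simp: PiE_def)
qed

lemma sum_card_lifts_generating:
  assumes fin: "finite (carrier G)" "finite I" and N: "N \<lhd> G"
    and A: "A \<in> I \<rightarrow> carrier (G Mod N)" "generate (G Mod N) (A ` I) = carrier (G Mod N)"
    and C: "C \<in> supplements N"
  shows "(\<Sum>D\<in>{D \<in> supplements N. D \<subseteq> C}. card (lifts_generating I A D)) = card (N \<inter> C) ^ card I"
proof -
  have sub: "subgroup C G" using C by (simp add: supplements_def)
  then have "C \<subseteq> carrier G" by (rule subgroup.subset)
  then have finC: "finite C" using fin(1) finite_subset by blast
  have "finite (\<Pi>\<^sub>E i\<in>I. A i \<inter> C)"
    using fin(2) finC by (simp add: finite_PiE)
  then have fin_lifts: "finite (lifts_generating I A D)" if "D \<in> supplements N" "D \<subseteq> C" for D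
    using that lifts_in_subgroup_eq_UN[OF N A sub] by (auto intro: finite_subset[rotated])
  have "(\<Sum>D\<in>{D \<in> supplements N. D \<subseteq> C}. card (lifts_generating I A D)) =
        card (\<Pi>\<^sub>E i\<in>I. A i \<inter> C)"
    unfolding lifts_in_subgroup_eq_UN[OF N A sub]
    by (rule card_UN_disjoint[symmetric])
       (use finC fin_lifts in \<open>auto simp: lifts_generating_def\<close>)
  also have "\<dots> = (\<Prod>i\<in>I. card (A i \<inter> C))"
    using fin(2) by (rule card_PiE)
  also have "\<dots> = (\<Prod>i\<in>I. card (N \<inter> C))"
    using A(1) card_coset_Int_supplement[OF N C] by (intro prod.cong) auto
  finally show ?thesis by simp
qed

text \<open>
  The right-hand side of \<open>sum_card_lifts_generating\<close> does not mention the family \<open>A\<close>, and the terms with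
  \<open>D \<subset> C\<close> are independent of \<open>A\<close> by induction; hence so is the term with \<open>D = C\<close>.
\<close>
lemma card_lifts_generating_independent:
  assumes fin: "finite (carrier G)" "finite I" and N: "N \<lhd> G"
    and A: "A \<in> I \<rightarrow> carrier (G Mod N)" "generate (G Mod N) (A ` I) = carrier (G Mod N)"
    and B: "B \<in> I \<rightarrow> carrier (G Mod N)" "generate (G Mod N) (B ` I) = carrier (G Mod N)"
    and C: "C \<in> supplements N"
  shows "card (lifts_generating I A C) = card (lifts_generating I B C)"
proof -
  have "C \<subseteq> carrier G"
    using C by (simp add: supplements_def subgroup.subset)
  then have "finite C" using fin(1) finite_subset by blast
  then show ?thesis
    using C
  proof (induction C rule: finite_psubset_induct)
    case (psubset C)
    let ?S = "{D \<in> supplements N. D \<subseteq> C}"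
    have finS: "finite ?S" and C_in: "C \<in> ?S"
      using psubset.hyps psubset.prems by auto
    have "(\<Sum>D\<in>?S - {C}. card (lifts_generating I A D)) =
          (\<Sum>D\<in>?S - {C}. card (lifts_generating I B D))"
      by (rule sum.cong) (use psubset.IH in auto)
    moreover have "(\<Sum>D\<in>?S. card (lifts_generating I A D)) = (\<Sum>D\<in>?S. card (lifts_generating I B D))"
      using sum_card_lifts_generating[OF fin N _ _ psubset.prems] A B by simp
    ultimately show ?case
      by (simp add: sum.remove[OF finS C_in])
  qed
qed

text \<open>
  Gaschuetz's lemma. The cosets of the entries of \<open>b\<close> have a generating lift, namely \<open>b\<close>, and \<open>A\<close> has
  as many generating lifts as they have.
\<close>
theorem generating_family_lifts:
  assumes fin: "finite (carrier G)" "finite I" and N: "N \<lhd> G"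
    and A: "A \<in> I \<rightarrow> carrier (G Mod N)" "generate (G Mod N) (A ` I) = carrier (G Mod N)"
    and b: "b \<in> I \<rightarrow> carrier G" "generate G (b ` I) = carrier G"
  obtains t where "t \<in> Pi\<^sub>E I A" "generate G (t ` I) = carrier G"
proof -
  interpret N: normal N G by fact
  interpret quot: group_hom G "G Mod N" "\<lambda>g. N #> g"
    by (intro group_hom.intro group_hom_axioms.intro is_group N.factorgroup_is_group N.r_coset_hom_Mod)
  define B where "B i = N #> b i" for i
  have B: "B \<in> I \<rightarrow> carrier (G Mod N)"
    using b(1) by (auto simp: B_def carrier_FactGroup)
  have "b ` I \<subseteq> carrier G"
    using b(1) by auto
  then have B_gen: "generate (G Mod N) (B ` I) = carrier (G Mod N)"
    using quot.generate_img[of "b ` I"] b(2)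
    by (simp add: B_def[abs_def] image_image carrier_FactGroup)
  have "carrier G \<in> supplements N"
    using subgroup_self by (simp add: supplements_def carrier_FactGroup)
  then have same: "card (lifts_generating I A (carrier G)) = card (lifts_generating I B (carrier G))"
    by (rule card_lifts_generating_independent[OF fin N A B B_gen])
  have "B i \<subseteq> carrier G" if "i \<in> I" for i
    using B that coset_eq_of_mem(1)[OF N] by blast
  then have "finite (Pi\<^sub>E I B)"
    using fin finite_subset by (intro finite_PiE) blast+
  then have "finite (lifts_generating I B (carrier G))"
    by (simp add: lifts_generating_def)
  moreover have "restrict b I \<in> lifts_generating I B (carrier G)"
    using b rcos_self[OF _ N.subgroup_axioms]
    by (simp add: lifts_generating_def B_def restrict_PiE_iff Pi_iff)
  ultimately have "card (lifts_generating I A (carrier G)) \<noteq> 0"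
    unfolding same by auto
  then have "lifts_generating I A (carrier G) \<noteq> {}"
    by force
  then show thesis
    using that by (auto simp: lifts_generating_def)
qed

corollary generating_pair_lifts:
  assumes fin: "finite (carrier G)" and N: "N \<lhd> G"
    and AB: "A \<in> carrier (G Mod N)" "B \<in> carrier (G Mod N)"
      "generate (G Mod N) {A, B} = carrier (G Mod N)"
    and ab: "a \<in> carrier G" "b \<in> carrier G" "generate G {a, b} = carrier G"
  obtains u v where "u \<in> A" "v \<in> B" "generate G {u, v} = carrier G"
proof -
  have image_bool: "f ` (UNIV :: bool set) = {f True, f False}" for f :: "bool \<Rightarrow> 'x"
    by (simp add: UNIV_bool insert_commute)
  obtain t where t: "t \<in> Pi\<^sub>E UNIV (case_bool A B)" "generate G (t ` UNIV) = carrier G"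
    by (rule generating_family_lifts[OF fin finite N, of "case_bool A B" UNIV "case_bool a b"])
       (use AB ab in \<open>auto simp: image_bool split: bool.splits\<close>)
  have "t True \<in> A" "t False \<in> B"
    using PiE_mem[OF t(1), of True] PiE_mem[OF t(1), of False] by simp_all
  with t(2) show thesis
    using that by (simp add: image_bool)
qed

end

section \<open>Isoclinism\<close>

lemma ord_iso_eq:
  assumes "group G" "group H" and h: "h \<in> iso G H" and x: "x \<in> carrier G"
  shows "group.ord H (h x) = group.ord G x"
proof -
  interpret G: group G by fact
  interpret H: group H by fact
  interpret h: group_hom G H h
    using h by unfold_locales (simp add: iso_def)
  have inj: "inj_on h (carrier G)"
    using h by (simp add: iso_def bij_betw_def)
  have "h x [^]\<^bsub>H\<^esub> n = \<one>\<^bsub>H\<^esub> \<longleftrightarrow> x [^]\<^bsub>G\<^esub> n = \<one>\<^bsub>G\<^esub>" for n :: nat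
    using inj_on_eq_iff[OF inj, of "x [^]\<^bsub>G\<^esub> n" "\<one>\<^bsub>G\<^esub>"] x by (simp add: h.hom_nat_pow)
  then show ?thesis
    by (simp add: group.ord_def)
qed

context group
begin

lemma group_derived_group: "group (derived_group G)"
  by (rule subgroup_imp_group[OF derived_is_subgroup]) simp

lemma ord_derived_group: "group.ord (derived_group G) x = ord x"
  by (simp add: ord_def group.ord_def[OF group_derived_group] flip: nat_pow_consistent)

lemma commutator_in_derived:
  assumes "x \<in> carrier G" "y \<in> carrier G"
  shows "commutator G x y \<in> derived G (carrier G)"
  unfolding derived_eq_generate_commutators using assms by (intro generate.incl) blast

lemma coset_commutator_eq:
  assumes "A \<in> carrier (G Mod center G)" "B \<in> carrier (G Mod center G)" "u \<in> A" "v \<in> B"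
  shows "coset_commutator G A B = commutator G u v"
  using coset_commutator_rcos[of u v] coset_eq_of_mem[OF center_normal] assms by metis

lemma coset_commutator_in_derived:
  assumes "A \<in> carrier (G Mod center G)" "B \<in> carrier (G Mod center G)"
  shows "coset_commutator G A B \<in> derived G (carrier G)"
  using assms by (auto simp: carrier_FactGroup coset_commutator_rcos commutator_in_derived)

end

lemma isoclinic_sym:
  assumes "group G" "group H" "isoclinic G H"
  shows "isoclinic H G"
proof -
  interpret G: group G by fact
  interpret H: group H by fact
  obtain \<phi> \<psi> where \<phi>: "\<phi> \<in> iso (G Mod center G) (H Mod center H)"
    and \<psi>: "\<psi> \<in> iso (derived_group G) (derived_group H)"
    and comm: "\<And>A B. A \<in> carrier (G Mod center G) \<Longrightarrow> B \<in> carrier (G Mod center G) \<Longrightarrow>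
        \<psi> (coset_commutator G A B) = coset_commutator H (\<phi> A) (\<phi> B)"
    using assms(3) unfolding isoclinic_def by blast
  let ?\<phi>' = "inv_into (carrier (G Mod center G)) \<phi>"
  let ?\<psi>' = "inv_into (carrier (derived_group G)) \<psi>"
  have \<phi>': "?\<phi>' \<in> iso (H Mod center H) (G Mod center G)"
    using normal.factorgroup_is_group[OF G.center_normal] \<phi> by (rule group.iso_set_sym)
  have \<psi>': "?\<psi>' \<in> iso (derived_group H) (derived_group G)"
    using G.group_derived_group \<psi> by (rule group.iso_set_sym)
  have "?\<psi>' (coset_commutator H A B) = coset_commutator G (?\<phi>' A) (?\<phi>' B)"
    if AB: "A \<in> carrier (H Mod center H)" "B \<in> carrier (H Mod center H)" for A B
  proof (rule inv_into_f_eq)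
    show "inj_on \<psi> (carrier (derived_group G))"
      using \<psi> by (simp add: iso_def bij_betw_def)
    have preimages: "?\<phi>' A \<in> carrier (G Mod center G)" "?\<phi>' B \<in> carrier (G Mod center G)"
      using \<phi>' AB by (auto simp: iso_def bij_betw_def)
    show "coset_commutator G (?\<phi>' A) (?\<phi>' B) \<in> carrier (derived_group G)"
      using G.coset_commutator_in_derived[OF preimages] by simp
    have "\<phi> (?\<phi>' A) = A" "\<phi> (?\<phi>' B) = B"
      using \<phi> AB by (auto simp: iso_def bij_betw_def f_inv_into_f)
    then show "\<psi> (coset_commutator G (?\<phi>' A) (?\<phi>' B)) = coset_commutator H A B"
      using comm[OF preimages] by simp
  qed
  then show ?thesis
    unfolding isoclinic_def using \<phi>' \<psi>' by blast
qed

text \<open>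
  Composing the quotient map of \<open>G\<close> with \<open>\<phi>\<close> gives a surjection \<open>f\<close> onto \<open>H Mod center H\<close>, so the cosets
  \<open>f x\<close> and \<open>f y\<close> generate this quotient. Any representatives of them have the right commutator;
  Gaschuetz's lemma provides representatives that generate \<open>H\<close>.
\<close>
lemma isoclinic_generating_pair:
  assumes "group G" "group H" "isoclinic G H" and fin: "finite (carrier H)"
    and H_gen: "\<exists>a \<in> carrier H. \<exists>b \<in> carrier H. generate H {a, b} = carrier H"
    and xy: "x \<in> carrier G" "y \<in> carrier G" "generate G {x, y} = carrier G"
  obtains u v where "u \<in> carrier H" "v \<in> carrier H" "generate H {u, v} = carrier H"
    "group.ord H (commutator H u v) = group.ord G (commutator G x y)"
proof -
  interpret G: group G by fact
  interpret H: group H by fact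
  interpret ZG: normal "center G" G by (rule G.center_normal)
  interpret ZH: normal "center H" H by (rule H.center_normal)
  obtain \<phi> \<psi> where \<phi>: "\<phi> \<in> iso (G Mod center G) (H Mod center H)"
    and \<psi>: "\<psi> \<in> iso (derived_group G) (derived_group H)"
    and comm: "\<And>A B. A \<in> carrier (G Mod center G) \<Longrightarrow> B \<in> carrier (G Mod center G) \<Longrightarrow>
        \<psi> (coset_commutator G A B) = coset_commutator H (\<phi> A) (\<phi> B)"
    using assms(3) unfolding isoclinic_def by blast
  define f where "f g = \<phi> (center G #>\<^bsub>G\<^esub> g)" for g
  have "\<phi> \<circ> (\<lambda>g. center G #>\<^bsub>G\<^esub> g) \<in> hom G (H Mod center H)"
    using ZG.r_coset_hom_Mod \<phi> unfolding iso_def by (blast intro: hom_compose)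
  then have "f \<in> hom G (H Mod center H)"
    by (simp add: f_def[abs_def] comp_def)
  then interpret f: group_hom G "H Mod center H" f
    by (intro group_hom.intro group_hom_axioms.intro G.is_group ZH.factorgroup_is_group)
  have "f ` carrier G = \<phi> ` carrier (G Mod center G)"
    by (simp add: f_def[abs_def] carrier_FactGroup image_image)
  then have f_surj: "f ` carrier G = carrier (H Mod center H)"
    using \<phi> by (simp add: iso_def bij_betw_def)
  have "generate (H Mod center H) {f x, f y} = carrier (H Mod center H)"
    using f.generate_img[of "{x, y}"] xy f_surj by simp
  moreover obtain a b where "a \<in> carrier H" "b \<in> carrier H" "generate H {a, b} = carrier H"
    using H_gen by blast
  ultimately obtain u v where uv: "u \<in> f x" "v \<in> f y" "generate H {u, v} = carrier H"
    using H.generating_pair_lifts[OF fin H.center_normal f.hom_closed[OF xy(1)] f.hom_closed[OF xy(2)]]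
    by metis
  have uv_carrier: "u \<in> carrier H" "v \<in> carrier H"
    using H.coset_eq_of_mem(1)[OF H.center_normal] uv(1,2) xy(1,2) f.hom_closed by blast+
  have "\<psi> (commutator G x y) = coset_commutator H (f x) (f y)"
    using comm[of "center G #>\<^bsub>G\<^esub> x" "center G #>\<^bsub>G\<^esub> y"] xy
    by (simp add: f_def carrier_FactGroup G.coset_commutator_rcos)
  also have "\<dots> = commutator H u v"
    using H.coset_commutator_eq uv xy f.hom_closed by simp
  finally have "group.ord H (commutator H u v) = group.ord (derived_group H) (\<psi> (commutator G x y))"
    by (simp add: H.ord_derived_group)
  also have "\<dots> = group.ord G (commutator G x y)"
    using ord_iso_eq[OF G.group_derived_group H.group_derived_group \<psi>] G.commutator_in_derived xy
    by (simp add: G.ord_derived_group)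
  finally show thesis
    using that uv_carrier uv(3) by blast
qed

theorem lemma3p10:
  fixes G1 :: "('a, 'c) monoid_scheme" and G2 :: "('b, 'd) monoid_scheme"
  assumes "group G1" and "finite (carrier G1)"
    and "group G2" and "finite (carrier G2)"
    and "\<exists>a \<in> carrier G1. \<exists>b \<in> carrier G1. generate G1 {a, b} = carrier G1"
    and "\<exists>a \<in> carrier G2. \<exists>b \<in> carrier G2. generate G2 {a, b} = carrier G2"
    and "isoclinic G1 G2"
  shows "{group.ord G1 (commutator G1 x y) | x y.
            x \<in> carrier G1 \<and> y \<in> carrier G1 \<and> generate G1 {x, y} = carrier G1} =
         {group.ord G2 (commutator G2 x y) | x y.
            x \<in> carrier G2 \<and> y \<in> carrier G2 \<and> generate G2 {x, y} = carrier G2}"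
proof (intro equalityI subsetI)
  fix n assume "n \<in> {group.ord G1 (commutator G1 x y) | x y.
      x \<in> carrier G1 \<and> y \<in> carrier G1 \<and> generate G1 {x, y} = carrier G1}"
  then obtain x y where n: "n = group.ord G1 (commutator G1 x y)"
    and xy: "x \<in> carrier G1" "y \<in> carrier G1" "generate G1 {x, y} = carrier G1"
    by blast
  show "n \<in> {group.ord G2 (commutator G2 x y) | x y.
      x \<in> carrier G2 \<and> y \<in> carrier G2 \<and> generate G2 {x, y} = carrier G2}"
    by (rule isoclinic_generating_pair[OF assms(1,3,7,4,6) xy]) (use n in force)
next
  fix n assume "n \<in> {group.ord G2 (commutator G2 x y) | x y.
      x \<in> carrier G2 \<and> y \<in> carrier G2 \<and> generate G2 {x, y} = carrier G2}"
  then obtain x y where n: "n = group.ord G2 (commutator G2 x y)"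
    and xy: "x \<in> carrier G2" "y \<in> carrier G2" "generate G2 {x, y} = carrier G2"
    by blast
  show "n \<in> {group.ord G1 (commutator G1 x y) | x y.
      x \<in> carrier G1 \<and> y \<in> carrier G1 \<and> generate G1 {x, y} = carrier G1}"
    by (rule isoclinic_generating_pair[OF assms(3,1) isoclinic_sym[OF assms(1,3,7)] assms(2,5) xy])
       (use n in force)
qed

end
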